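(* There is a function $\varepsilon:\mathbb{N}\to\mathbb{R}$ with $\varepsilon(n)\to 0$ as $n\to\infty$ such that for every $n$ and every monotone 2-CNF formula $\varphi$ on $n$ variables there is a 2-CNF formula $\varphi'$ with $\varphi \Rightarrow^{*}_{\mathrm{BVA}} \varphi'$ and $|\varphi'| \le \left(\frac{1}{4}+\varepsilon(n)\right)\frac{n^2}{\lg n}$.
   Context: A literal is a variable $x$ or its negation $\overline{x}$. A clause is a set of non-complementary literals, a formula is a set of clauses, and $|\varphi|$ is the number of clauses; $\textsf{Var}(\varphi)$ is the set of variables of $\varphi$. A formula is 2-CNF if every clause has exactly two literals, and monotone if all its literals are positive (unnegated variables). $\lg$ is the base-2 logarithm. BVA step: let $\varphi$ be a formula, let $\mathcal{C},\mathcal{D}$ be sets of nonempty clauses such that $\mathcal{C}\bowtie\mathcal{D} := \{C\cup D : C\in\mathcal{C}, D\in\mathcal{D}\}\subseteq\varphi$, and let $y\notin\textsf{Var}(\varphi)$ be fresh. Then $\varphi' := (\varphi\setminus(\mathcal{C}\bowtie\mathcal{D}))\cup\{C\cup\{y\} : C\in\mathcal{C}\}\cup\{\{\overline{y}\}\cup D : D\in\mathcal{D}\}$ is derived in one BVA step, written $\varphi\Rightarrow_{\mathrm{BVA}}\varphi'$; $\Rightarrow^{*}_{\mathrm{BVA}}$ is the reflexive transitive closure of $\Rightarrow_{\mathrm{BVA}}$. *)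

theory Defs
  imports Complex_Main "HOL-Library.Infinite_Typeclass"
begin

datatype 'v literal = Pos 'v | Neg 'v

primrec var_of :: "'v literal \<Rightarrow> 'v" where
  "var_of (Pos x) = x"
| "var_of (Neg x) = x"

primrec negate :: "'v literal \<Rightarrow> 'v literal" where
  "negate (Pos x) = Neg x"
| "negate (Neg x) = Pos x"

definition is_clause :: "'v literal set \<Rightarrow> bool" where
  "is_clause C \<longleftrightarrow> finite C \<and> (\<forall>l\<in>C. negate l \<notin> C)"

definition is_formula :: "'v literal set set \<Rightarrow> bool" where
  "is_formula \<phi> \<longleftrightarrow> finite \<phi> \<and> (\<forall>C\<in>\<phi>. is_clause C)"

definition Var :: "'v literal set set \<Rightarrow> 'v set" where
  "Var \<phi> = var_of ` (\<Union>\<phi>)"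

definition two_cnf :: "'v literal set set \<Rightarrow> bool" where
  "two_cnf \<phi> \<longleftrightarrow> is_formula \<phi> \<and> (\<forall>C\<in>\<phi>. card C = 2)"

definition monotone_formula :: "'v literal set set \<Rightarrow> bool" where
  "monotone_formula \<phi> \<longleftrightarrow> is_formula \<phi> \<and> (\<forall>C\<in>\<phi>. \<forall>l\<in>C. \<exists>x. l = Pos x)"

definition clause_join ::
    "'v literal set set \<Rightarrow> 'v literal set set \<Rightarrow> 'v literal set set" (infixl "\<bowtie>" 70) where
  "\<C> \<bowtie> \<D> = {C \<union> D | C D. C \<in> \<C> \<and> D \<in> \<D>}"

text \<open>
  The sets \<open>\<C>\<close> and \<open>\<D>\<close> may be empty. Then the join is empty as well and does not
  constrain the other set, so the result is required explicitly to be a formula; when both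
  sets are nonempty this requirement is automatic.
\<close>

definition bva_step :: "'v literal set set \<Rightarrow> 'v literal set set \<Rightarrow> bool" where
  "bva_step \<phi> \<phi>' \<longleftrightarrow> is_formula \<phi> \<and> is_formula \<phi>' \<and>
     (\<exists>\<C> \<D> y.
        (\<forall>C\<in>\<C>. is_clause C \<and> C \<noteq> {}) \<and>
        (\<forall>D\<in>\<D>. is_clause D \<and> D \<noteq> {}) \<and>
        \<C> \<bowtie> \<D> \<subseteq> \<phi> \<and>
        y \<notin> Var \<phi> \<and>
        \<phi>' = (\<phi> - (\<C> \<bowtie> \<D>)) \<union> {C \<union> {Pos y} | C. C \<in> \<C>} \<union> {{Neg y} \<union> D | D. D \<in> \<D>})"

end

theory Submission
  imports Defs "HOL-Real_Asymp.Real_Asymp"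
begin

text \<open>
  Order the variables of \<open>\<phi>\<close> and view its clauses as the ones of a strictly upper triangular
  matrix. Cut the columns into blocks of width \<open>k\<close>. The rows that show the same nonempty pattern
  \<open>p\<close> in the \<open>j\<close>-th column block form a biclique with \<open>p\<close>, and one BVA step with a new
  variable \<open>v\<close> handles it (Lupanov). What remains are about \<open>n\<^sup>2 / (2 * k)\<close> clauses
  \<open>{x, v}\<close>, one for each row and column block. To save another factor 2, cut the rows into blocks
  of length \<open>s\<close> as well, and pair up rows of the same row block that have the same pattern
  (Nechiporuk). Each pair \<open>{x, x'}\<close> gets a new variable \<open>u\<close>, and a second round of BVA steps
  replaces \<open>{x, v}, {x', v}\<close> by the single clause \<open>{\<not> u, v}\<close>. With \<open>2 ^ k\<close> and \<open>s\<close> equal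
  to \<open>n\<close> up to powers of \<open>log 2 n\<close>, all other clauses are of lower order.
\<close>

section \<open>Elementary facts on literals, clauses and 2-CNF formulas\<close>

lemma finite_Union_formula: "is_formula \<phi> \<Longrightarrow> finite (\<Union>\<phi>)"
  by (auto simp: is_formula_def is_clause_def)

lemma finite_Var: "is_formula \<phi> \<Longrightarrow> finite (Var \<phi>)"
  by (simp add: Var_def finite_Union_formula)

lemma var_of_in_Var: "C \<in> \<phi> \<Longrightarrow> l \<in> C \<Longrightarrow> var_of l \<in> Var \<phi>"
  by (auto simp: Var_def)

lemma is_clause_singleton: "is_clause {l}"
  by (cases l) (auto simp: is_clause_def)

lemma is_clause_doubleton: "var_of l \<noteq> var_of l' \<Longrightarrow> is_clause {l, l'}"
  by (cases l; cases l') (auto simp: is_clause_def)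

lemma card_doubleton_literals: "var_of l \<noteq> var_of l' \<Longrightarrow> card {l, l'} = 2"
  by (auto simp: card_2_iff)

lemma two_cnf_Un: "two_cnf \<phi> \<Longrightarrow> two_cnf \<psi> \<Longrightarrow> two_cnf (\<phi> \<union> \<psi>)"
  by (auto simp: two_cnf_def is_formula_def)

lemma two_cnf_subset: "two_cnf \<phi> \<Longrightarrow> \<psi> \<subseteq> \<phi> \<Longrightarrow> two_cnf \<psi>"
  by (auto simp: two_cnf_def is_formula_def intro: finite_subset)

section \<open>BVA steps on bicliques\<close>

text \<open>The step is taken with the singletons of \<open>A\<close> and of \<open>B\<close> as its
  two sets of clauses. As both sides are nonempty, every literal of \<open>A\<close> and
  \<open>B\<close> occurs in a clause of \<phi>, so the two sets are finite and do not involve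
  \<open>y\<close>.\<close>

lemma bva_step_biclique:
  assumes \<phi>: "two_cnf \<phi>" and A: "A \<noteq> {}" and B: "B \<noteq> {}"
    and AB: "\<And>a b. a \<in> A \<Longrightarrow> b \<in> B \<Longrightarrow> {a, b} \<in> \<phi>"
    and y: "y \<notin> Var \<phi>"
    and \<phi>': "\<phi>' = (\<phi> - {{a, b} |a b. a \<in> A \<and> b \<in> B})
                 \<union> {{a, Pos y} |a. a \<in> A} \<union> {{Neg y, b} |b. b \<in> B}"
  shows "two_cnf \<phi>'" "bva_step \<phi> \<phi>'"
proof -
  have fin: "finite (\<Union>\<phi>)"
    using \<phi> by (auto simp: two_cnf_def intro: finite_Union_formula)
  have sub: "A \<subseteq> \<Union>\<phi>" "B \<subseteq> \<Union>\<phi>"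
    using A B AB by blast+
  hence finAB: "finite A" "finite B"
    using fin finite_subset by blast+
  have ne: "var_of l \<noteq> y" if "l \<in> A \<union> B" for l
    using that sub y by (auto simp: Var_def)
  have "two_cnf {{a, Pos y} |a. a \<in> A}"
    using finAB ne by (auto simp: two_cnf_def is_formula_def is_clause_doubleton card_doubleton_literals)
  moreover have "two_cnf {{Neg y, b} |b. b \<in> B}"
    using finAB ne[THEN not_sym]
    by (auto simp: two_cnf_def is_formula_def is_clause_doubleton card_doubleton_literals)
  ultimately show tc: "two_cnf \<phi>'"
    unfolding \<phi>' using \<phi> two_cnf_subset[of \<phi>] by (intro two_cnf_Un) auto
  let ?C = "(\<lambda>l. {l}) ` A" and ?D = "(\<lambda>l. {l}) ` B"
  have join: "?C \<bowtie> ?D = {{a, b} |a b. a \<in> A \<and> b \<in> B}"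
    by (auto simp: clause_join_def)
  have "{C \<union> {Pos y} |C. C \<in> ?C} = {{a, Pos y} |a. a \<in> A}"
    "{{Neg y} \<union> D |D. D \<in> ?D} = {{Neg y, b} |b. b \<in> B}"
    by auto
  hence eq: "\<phi>' = (\<phi> - ?C \<bowtie> ?D) \<union> {C \<union> {Pos y} |C. C \<in> ?C} \<union> {{Neg y} \<union> D |D. D \<in> ?D}"
    by (simp only: \<phi>' join)
  have "?C \<bowtie> ?D \<subseteq> \<phi>"
    unfolding join using AB by blast
  moreover have "\<forall>C\<in>?C. is_clause C \<and> C \<noteq> {}" "\<forall>D\<in>?D. is_clause D \<and> D \<noteq> {}"
    by (simp_all add: is_clause_singleton)
  ultimately show "bva_step \<phi> \<phi>'"
    unfolding bva_step_def
    using tc \<phi> y eq unfolding two_cnf_def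
    by (intro conjI exI[of _ ?C] exI[of _ ?D] exI[of _ y]) simp_all
qed

text \<open>Induction on \<open>I\<close>, one step per biclique. As the edge sets
  \<open>E i\<close> are disjoint, earlier steps leave the edges of the next biclique in place. The
  result has a closed form that does not depend on the order of the steps.\<close>

lemma bva_bicliques:
  fixes A B :: "'i \<Rightarrow> 'v literal set" and v :: "'i \<Rightarrow> 'v"
  defines "E \<equiv> \<lambda>i. {{a, b} |a b. a \<in> A i \<and> b \<in> B i}"
  defines "\<phi>' \<equiv> \<lambda>\<phi> I. (\<phi> - (\<Union>i\<in>I. E i)) \<union> (\<Union>i\<in>I. {{a, Pos (v i)} |a. a \<in> A i})
                        \<union> (\<Union>i\<in>I. {{Neg (v i), b} |b. b \<in> B i})"
  assumes I: "finite I" and \<phi>: "two_cnf \<phi>"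
    and ne: "\<And>i. i \<in> I \<Longrightarrow> A i \<noteq> {} \<and> B i \<noteq> {}"
    and AB: "\<And>i a b. i \<in> I \<Longrightarrow> a \<in> A i \<Longrightarrow> b \<in> B i \<Longrightarrow> {a, b} \<in> \<phi>"
    and disj: "\<And>i j. i \<in> I \<Longrightarrow> j \<in> I \<Longrightarrow> i \<noteq> j \<Longrightarrow> E i \<inter> E j = {}"
    and v: "inj_on v I" "v ` I \<inter> Var \<phi> = {}"
  shows "two_cnf (\<phi>' \<phi> I) \<and> bva_step\<^sup>*\<^sup>* \<phi> (\<phi>' \<phi> I)"
  using I ne AB disj v
proof (induction I rule: finite_induct)
  case empty
  then show ?case using \<phi> by (simp add: \<phi>'_def)
next
  case (insert i I)
  let ?\<psi> = "\<phi>' \<phi> I"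
  have IH: "two_cnf ?\<psi>" "bva_step\<^sup>*\<^sup>* \<phi> ?\<psi>"
    using insert.IH insert.prems by auto
  have mem: "{a, b} \<in> \<phi>" if "j \<in> insert i I" "a \<in> A j" "b \<in> B j" for j a b
    using insert.prems(2) that by blast
  have inVar: "var_of l \<in> Var \<phi>" if l: "l \<in> A j \<union> B j" "j \<in> insert i I" for j l
  proof -
    obtain a b where "a \<in> A j" "b \<in> B j"
      using l(2) insert.prems(1)[of j] by auto
    with l consider "{l, b} \<in> \<phi>" | "{a, l} \<in> \<phi>"
      using mem by auto
    thus ?thesis
      by cases (auto intro: var_of_in_Var)
  qed
  have Ei: "E i \<subseteq> ?\<psi>"
  proof
    fix C assume C: "C \<in> E i"
    hence "C \<in> \<phi>"
      using mem[of i] by (auto simp: E_def)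
    moreover have "C \<notin> E j" if "j \<in> I" for j
      using insert.prems(3)[of i j] insert.hyps that C by auto
    ultimately show "C \<in> ?\<psi>"
      by (auto simp: \<phi>'_def)
  qed
  have vi: "v i \<notin> Var \<phi>" "v i \<notin> v ` I"
    using insert.prems(4,5) insert.hyps by (auto simp: inj_on_def)
  have "Var ?\<psi> \<subseteq> Var \<phi> \<union> v ` I"
  proof
    fix x assume "x \<in> Var ?\<psi>"
    then obtain C l where C: "C \<in> ?\<psi>" "l \<in> C" "x = var_of l"
      by (auto simp: Var_def)
    then consider "C \<in> \<phi>" | j a where "j \<in> I" "a \<in> A j" "C = {a, Pos (v j)}"
      | j b where "j \<in> I" "b \<in> B j" "C = {Neg (v j), b}"
      unfolding \<phi>'_def by blast
    thus "x \<in> Var \<phi> \<union> v ` I"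
      using C(2,3) inVar by cases (auto intro: var_of_in_Var)
  qed
  hence fresh: "v i \<notin> Var ?\<psi>"
    using vi by blast
  \<comment> \<open>A clause introduced by an earlier step contains \<open>v j\<close>, whereas the
    edges removed now only have variables of \<phi>; so it survives.\<close>
  have keep: "{a, Pos (v j)} \<notin> E i" "{Neg (v j), b} \<notin> E i" if "j \<in> I" for j a b
  proof -
    have "v j \<notin> Var \<phi>"
      using insert.prems(5) that by auto
    moreover have "var_of l \<in> Var \<phi>" if "C \<in> E i" "l \<in> C" for C l
      using that inVar[of _ i] by (auto simp: E_def)
    ultimately show "{a, Pos (v j)} \<notin> E i" "{Neg (v j), b} \<notin> E i"
      by (metis insertI1 insertI2 var_of.simps)+
  qed
  have "\<phi>' \<phi> (insert i I) = (?\<psi> - E i) \<union> {{a, Pos (v i)} |a. a \<in> A i} \<union> {{Neg (v i), b} |b. b \<in> B i}"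
    using keep unfolding \<phi>'_def by blast
  from bva_step_biclique[OF IH(1) _ _ _ fresh this[unfolded E_def]] insert.prems(1)[of i] Ei IH(2)
  show ?case
    by (auto simp: E_def intro: rtranclp.rtrancl_into_rtrancl)
qed

section \<open>Pairings, fresh variables and counting tools\<close>

text \<open>Greedy matching: as long as two elements have the same value under \<open>g\<close>,
  they are split off as a pair. When this stops, \<open>g\<close> is injective on the remaining
  elements, so there are no more of them than values.\<close>

lemma exists_pairing:
  assumes "finite X"
  shows "\<exists>M. (\<forall>e\<in>M. e \<subseteq> X \<and> card e = 2 \<and> (\<forall>a\<in>e. \<forall>b\<in>e. g a = g b)) \<and>
    (\<forall>e\<in>M. \<forall>e'\<in>M. e \<noteq> e' \<longrightarrow> e \<inter> e' = {}) \<and>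
    2 * card M \<le> card X \<and> card (X - \<Union>M) \<le> card (g ` X)"
  using assms
proof (induction "card X" arbitrary: X rule: less_induct)
  case less
  show ?case
  proof (cases "inj_on g X")
    case True
    then show ?thesis
      by (intro exI[of _ "{}"]) (simp add: card_image)
  next
    case False
    then obtain a b where ab: "a \<in> X" "b \<in> X" "a \<noteq> b" "g a = g b"
      by (auto simp: inj_on_def)
    define Y where "Y = X - {a, b}"
    have cY: "card X = card Y + 2"
      using ab less.prems card_mono[of X "{a, b}"] by (simp add: Y_def card_Diff_subset)
    obtain M where M: "\<forall>e\<in>M. e \<subseteq> Y \<and> card e = 2 \<and> (\<forall>a\<in>e. \<forall>b\<in>e. g a = g b)"
      "\<forall>e\<in>M. \<forall>e'\<in>M. e \<noteq> e' \<longrightarrow> e \<inter> e' = {}"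
      "2 * card M \<le> card Y" "card (Y - \<Union>M) \<le> card (g ` Y)"
      using less.hyps[of Y] less.prems cY by (auto simp: Y_def)
    have "M \<subseteq> Pow Y"
      using M(1) by auto
    hence "finite M"
      using less.prems by (auto simp: Y_def intro: finite_subset)
    hence "card (insert {a, b} M) \<le> card M + 1"
      by (simp add: card_insert_if)
    hence size: "2 * card (insert {a, b} M) \<le> card X"
      using M(3) cY by linarith
    have "card (g ` Y) \<le> card (g ` X)"
      using less.prems by (intro card_mono) (auto simp: Y_def)
    moreover have "X - \<Union>(insert {a, b} M) = Y - \<Union>M"
      by (auto simp: Y_def)
    ultimately have rest: "card (X - \<Union>(insert {a, b} M)) \<le> card (g ` X)"
      using M(4) by simp
    have "{a, b} \<inter> e = {}" if "e \<in> M" for e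
      using M(1) that by (auto simp: Y_def)
    hence disj: "\<forall>e\<in>insert {a, b} M. \<forall>e'\<in>insert {a, b} M. e \<noteq> e' \<longrightarrow> e \<inter> e' = {}"
      using M(2) by (simp add: Int_commute)
    have "{a, b} \<subseteq> X \<and> card {a, b} = 2 \<and> (\<forall>x\<in>{a, b}. \<forall>y\<in>{a, b}. g x = g y)"
      using ab by simp
    moreover have "\<forall>e\<in>M. e \<subseteq> X \<and> card e = 2 \<and> (\<forall>a\<in>e. \<forall>b\<in>e. g a = g b)"
      using M(1) by (auto simp only: Y_def)
    ultimately have "\<forall>e\<in>insert {a, b} M. e \<subseteq> X \<and> card e = 2 \<and> (\<forall>a\<in>e. \<forall>b\<in>e. g a = g b)"
      unfolding ball_simps by (rule conjI)
    with size rest disj show ?thesis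
      by (intro exI conjI)
  qed
qed

lemma obtain_fresh_variables:
  fixes V :: "'v::infinite set"
  assumes "finite I" "finite V"
  obtains v :: "'i \<Rightarrow> 'v" where "inj_on v I" "v ` I \<inter> V = {}"
proof -
  have "infinite (UNIV - V)"
    using assms by (simp add: infinite_UNIV)
  then obtain W where W: "W \<subseteq> UNIV - V" "card W = card I" "finite W"
    by (metis infinite_arbitrarily_large)
  then obtain v where "bij_betw v I W"
    using assms(1) finite_same_card_bij by metis
  with W that[of v] show ?thesis
    by (auto simp: bij_betw_def)
qed

text \<open>A doubleton is coded by \<open>a\<close> and the residue \<open>b mod s\<close>, since
  the block of \<open>a\<close> is also the block of \<open>b\<close>. This serves both for the
  clauses inside one column block and for the pairs of rows inside one row block.\<close>

lemma card_doubletons_in_blocks: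
  assumes "s > 0"
  shows "finite {{a, b} |a b. a < n \<and> b < n \<and> a div s = b div s}"
    and "card {{a, b} |a b. a < n \<and> b < n \<and> a div s = b div (s::nat)} \<le> n * s"
proof -
  let ?h = "\<lambda>(a, r). {a, (a div s) * s + r}"
  have sub: "{{a, b} |a b. a < n \<and> b < n \<and> a div s = b div s} \<subseteq> ?h ` ({..<n} \<times> {..<s})"
  proof clarify
    fix a b assume "a < n" "a div s = b div s"
    thus "{a, b} \<in> ?h ` ({..<n} \<times> {..<s})"
      using assms by (intro image_eqI[of _ _ "(a, b mod s)"]) auto
  qed
  show "finite {{a, b} |a b. a < n \<and> b < n \<and> a div s = b div s}"
    by (rule finite_subset[OF sub]) auto
  have "card {{a, b} |a b. a < n \<and> b < n \<and> a div s = b div s} \<le> card ({..<n} \<times> {..<s})"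
    by (rule surj_card_le[OF _ sub]) auto
  thus "card {{a, b} |a b. a < n \<and> b < n \<and> a div s = b div s} \<le> n * s"
    by simp
qed

lemma card_setcompr_Sigma_le:
  assumes "finite I" "\<And>i. i \<in> I \<Longrightarrow> finite (S i)"
  shows "finite {h i x |i x. i \<in> I \<and> x \<in> S i}"
    and "card {h i x |i x. i \<in> I \<and> x \<in> S i} \<le> (\<Sum>i\<in>I. card (S i))"
proof -
  have eq: "{h i x |i x. i \<in> I \<and> x \<in> S i} = (\<lambda>(i, x). h i x) ` Sigma I S"
    by auto
  show "finite {h i x |i x. i \<in> I \<and> x \<in> S i}"
    unfolding eq using assms by auto
  show "card {h i x |i x. i \<in> I \<and> x \<in> S i} \<le> (\<Sum>i\<in>I. card (S i))"
    unfolding eq using assms card_image_le[of "Sigma I S"] by (simp add: card_SigmaI)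
qed

section \<open>The construction with two rounds of BVA steps\<close>

text \<open>The summands count, in this order, the clauses inside one column block, the clauses of
  \<open>Neg v\<close> with the columns of a pattern, the clauses of \<open>v\<close> with unpaired
  rows, the clauses of \<open>u\<close> with the two rows of its pair, and the clauses of
  \<open>Neg u\<close> with \<open>v\<close>. For the last, the triangle has at most
  \<open>n * m / 2\<close> incidences of a row with a column block, and pairing halves this.\<close>

lemma bva_pattern_bound:
  fixes \<phi> :: "'v::infinite literal set set"
  assumes mono: "monotone_formula \<phi>" and \<phi>: "two_cnf \<phi>" and n: "card (Var \<phi>) = n"
    and k: "k > 0" and s: "s > 0"
  defines "m \<equiv> n div k + 1"
  shows "\<exists>\<phi>'. two_cnf \<phi>' \<and> bva_step\<^sup>*\<^sup>* \<phi> \<phi>' \<and>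
    real (card \<phi>') \<le> real (n * k + m * 2 ^ k * k + m * 2 ^ k * (n div s + 1) + 2 * (n * s)) + real (n * m) / 4"
proof -
  have finV: "finite (Var \<phi>)"
    using \<phi> by (simp add: two_cnf_def finite_Var)
  obtain f where f: "bij_betw f {..<n} (Var \<phi>)"
    using ex_bij_betw_nat_finite[OF finV] n by (auto simp: atLeast0LessThan)
  define x where "x a = Pos (f a)" for a
  have x_eq: "x a = x b \<longleftrightarrow> a = b" if "a < n" "b < n" for a b
    using f that by (auto simp: x_def bij_betw_def inj_on_def)
  have fV: "f a \<in> Var \<phi>" if "a < n" for a
    using f that by (auto simp: bij_betw_def)
  have edge: "\<exists>a b. a < b \<and> b < n \<and> C = {x a, x b}" if C: "C \<in> \<phi>" for C
  proof -
    obtain l l' where l: "C = {l, l'}" "l \<noteq> l'"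
      using \<phi> C by (auto simp: two_cnf_def card_2_iff)
    have "l'' \<in> x ` {..<n}" if "l'' \<in> C" for l''
    proof -
      obtain y where y: "l'' = Pos y"
        using mono C \<open>l'' \<in> C\<close> by (auto simp: monotone_formula_def)
      with C \<open>l'' \<in> C\<close> have "y \<in> Var \<phi>"
        using var_of_in_Var[of C \<phi> l''] by simp
      thus ?thesis
        using f y by (auto simp: bij_betw_def x_def)
    qed
    hence "l \<in> x ` {..<n}" "l' \<in> x ` {..<n}"
      using l by simp_all
    then obtain a b where ab: "a < n" "b < n" "l = x a" "l' = x b"
      by auto
    with l consider "a < b" | "b < a"
      using nat_neq_iff by auto
    thus ?thesis
      using ab l(1) by cases (blast, metis insert_commute)
  qed

  \<comment> \<open>Row patterns in column blocks\<close>
  define P where "P a j = {b. b < n \<and> b div k = j \<and> {x a, x b} \<in> \<phi>}" for a j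
  \<comment> \<open>An index \<open>q\<close> is a column block together with a pattern. The
    condition \<open>a < fst q * k\<close> keeps only rows above the whole block, so that
    \<open>a < b\<close> for each of its columns and no clause is seen from both of its
    ends.\<close>
  define R where "R q = {a. a < fst q * k \<and> P a (fst q) = snd q}" for q
  define I where "I = {q. R q \<noteq> {} \<and> snd q \<noteq> {}}"
  have snd_q: "b < n \<and> b div k = fst q \<and> fst q * k \<le> b" if q: "b \<in> snd q" "q \<in> I" for b q
  proof -
    obtain a where "snd q = P a (fst q)"
      using q(2) by (auto simp only: I_def R_def)
    with q(1) have "b \<in> P a (fst q)"
      by simp
    thus ?thesis
      using div_times_less_eq_dividend[of b k] by (auto simp: P_def)
  qed
  have R_less: "a < b" if "a \<in> R q" "b \<in> snd q" "q \<in> I" for a b q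
    using snd_q[OF that(2,3)] that(1) by (auto simp: R_def)
  have R_n: "a < n" if a: "a \<in> R q" and q: "q \<in> I" for a q
  proof -
    obtain b where "b \<in> snd q"
      using q by (auto simp: I_def)
    thus ?thesis
      using R_less[OF a _ q] snd_q[OF _ q] by fastforce
  qed
  have finR: "finite (R q)" for q
    by (rule finite_subset[of _ "{..<fst q * k}"]) (auto simp: R_def)
  have I_sub: "I \<subseteq> Sigma {..<m} (\<lambda>j. Pow {j * k..<j * k + k})"
  proof
    fix q assume q: "q \<in> I"
    obtain b where "b \<in> snd q"
      using q by (auto simp: I_def)
    hence "fst q < m"
      using snd_q[OF _ q, of b] div_le_mono[of b n k] by (auto simp: m_def)
    moreover have "b < fst q * k + k" if "b \<in> snd q" for b
      using snd_q[OF that q] dividend_less_div_times[OF k, of b] by auto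
    ultimately show "q \<in> Sigma {..<m} (\<lambda>j. Pow {j * k..<j * k + k})"
      using snd_q[OF _ q] by (cases q) auto
  qed
  have finI: "finite I"
    by (rule finite_subset[OF I_sub]) auto
  have card_I: "card I \<le> m * 2 ^ k"
    using card_mono[OF _ I_sub] by (simp add: card_Pow)
  have fin_snd: "finite (snd q)" and card_snd: "card (snd q) \<le> k" if "q \<in> I" for q
  proof -
    have "snd q \<subseteq> {fst q * k..<fst q * k + k}"
      using I_sub that by (cases q) auto
    thus "finite (snd q)" "card (snd q) \<le> k"
      using card_mono[of "{fst q * k..<fst q * k + k}" "snd q"] by (auto intro: finite_subset)
  qed

  \<comment> \<open>First round: one new variable per block and pattern\<close>
  define E where "E q = {{l, l'} |l l'. l \<in> x ` R q \<and> l' \<in> x ` snd q}" for q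
  \<comment> \<open>A clause determines its indices \<open>a < b\<close>, hence the block
    \<open>b div k\<close>, hence the pattern of row \<open>a\<close> in this block, and so all of
    \<open>q\<close>.\<close>
  have E_disj: "E q \<inter> E q' = {}" if q: "q \<in> I" "q' \<in> I" "q \<noteq> q'" for q q'
  proof (rule ccontr)
    assume "E q \<inter> E q' \<noteq> {}"
    then obtain a b a' b' where ab: "a \<in> R q" "b \<in> snd q" "a' \<in> R q'" "b' \<in> snd q'"
      and eq: "{x a, x b} = {x a', x b'}"
      by (auto simp: E_def)
    have "a < n" "a' < n" "b < n" "b' < n" "a < b" "a' < b'"
      using ab q R_n snd_q R_less by auto
    hence "a = a' \<and> b = b'"
      using eq by (auto simp: doubleton_eq_iff x_eq)
    hence "fst q = fst q'"
      using snd_q[OF ab(2) q(1)] snd_q[OF ab(4) q(2)] by simp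
    moreover have "snd q = snd q'"
      using ab \<open>a = a' \<and> b = b'\<close> \<open>fst q = fst q'\<close> by (auto simp: R_def)
    ultimately show False
      using q(3) by (simp add: prod_eq_iff)
  qed
  have E_sub: "{l, l'} \<in> \<phi>" if l: "q \<in> I" "l \<in> x ` R q" "l' \<in> x ` snd q" for q l l'
  proof -
    obtain a b where ab: "a \<in> R q" "b \<in> snd q" "l = x a" "l' = x b"
      using l by blast
    hence "b \<in> P a (fst q)"
      by (simp add: R_def)
    with ab show ?thesis
      by (simp add: P_def)
  qed

  obtain v where v: "inj_on v I" "v ` I \<inter> Var \<phi> = {}"
    using obtain_fresh_variables[OF finI finV] by blast
  define \<psi> where "\<psi> = (\<phi> - (\<Union>q\<in>I. E q)) \<union> (\<Union>q\<in>I. {{l, Pos (v q)} |l. l \<in> x ` R q})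
                        \<union> (\<Union>q\<in>I. {{Neg (v q), l} |l. l \<in> x ` snd q})"
  have \<psi>: "two_cnf \<psi>" "bva_step\<^sup>*\<^sup>* \<phi> \<psi>"
    using bva_bicliques[of I \<phi> "\<lambda>q. x ` R q" "\<lambda>q. x ` snd q" v] finI \<phi> E_sub E_disj v
    unfolding \<psi>_def E_def by (auto simp: I_def)

  \<comment> \<open>Pairing rows of equal pattern inside row blocks\<close>
  have "\<forall>q. \<exists>M. (\<forall>e\<in>M. e \<subseteq> R q \<and> card e = 2 \<and> (\<forall>a\<in>e. \<forall>b\<in>e. a div s = b div s)) \<and>
    (\<forall>e\<in>M. \<forall>e'\<in>M. e \<noteq> e' \<longrightarrow> e \<inter> e' = {}) \<and>
    2 * card M \<le> card (R q) \<and> card (R q - \<Union>M) \<le> card ((\<lambda>a. a div s) ` R q)"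
    by (rule allI) (rule exists_pairing[OF finR])
  then obtain M where
    M_all: "\<forall>q. (\<forall>e\<in>M q. e \<subseteq> R q \<and> card e = 2 \<and> (\<forall>a\<in>e. \<forall>b\<in>e. a div s = b div s)) \<and>
    (\<forall>e\<in>M q. \<forall>e'\<in>M q. e \<noteq> e' \<longrightarrow> e \<inter> e' = {}) \<and>
    2 * card (M q) \<le> card (R q) \<and> card (R q - \<Union>(M q)) \<le> card ((\<lambda>a. a div s) ` R q)"
    by (rule exE[OF choice]) (rule that)
  have M: "\<And>q e. e \<in> M q \<Longrightarrow> e \<subseteq> R q" "\<And>q e. e \<in> M q \<Longrightarrow> card e = 2"
      "\<And>q e a b. e \<in> M q \<Longrightarrow> a \<in> e \<Longrightarrow> b \<in> e \<Longrightarrow> a div s = b div s"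
    and M_disj: "\<And>q e e'. e \<in> M q \<Longrightarrow> e' \<in> M q \<Longrightarrow> e \<noteq> e' \<Longrightarrow> e \<inter> e' = {}"
    and M_card: "\<And>q. 2 * card (M q) \<le> card (R q)"
    and M_rest: "\<And>q. card (R q - \<Union>(M q)) \<le> card ((\<lambda>a. a div s) ` R q)"
    using M_all[THEN spec] by blast+
  have finM: "finite (M q)" for q
  proof (rule finite_subset)
    show "M q \<subseteq> Pow (R q)"
      using M(1) by blast
  qed (simp add: finR)
  \<comment> \<open>The same pair can occur in \<open>M q\<close> for many \<open>q\<close>, but it
    is counted once in \<open>I'\<close> and gets a single variable; \<open>Q e\<close> collects
    these \<open>q\<close>. Hence the number of pairs is controlled by the row blocks alone,
    whatever the number of patterns.\<close>
  define I' where "I' = (\<Union>q\<in>I. M q)"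
  define Q where "Q e = {q \<in> I. e \<in> M q}" for e
  have finI': "finite I'"
    using finI finM by (auto simp: I'_def)
  have I'_sub: "I' \<subseteq> {{a, b} |a b. a < n \<and> b < n \<and> a div s = b div s}"
  proof
    fix e assume "e \<in> I'"
    then obtain q where q: "q \<in> I" "e \<in> M q"
      by (auto simp: I'_def)
    then obtain a b where ab: "e = {a, b}"
      using M(2) by (meson card_2_iff)
    have "a < n" "b < n" "a div s = b div s"
      using M(1)[OF q(2)] M(3)[OF q(2)] R_n[OF _ q(1)] ab by auto
    with ab show "e \<in> {{a, b} |a b. a < n \<and> b < n \<and> a div s = b div s}"
      by blast
  qed
  have card_I': "card I' \<le> n * s"
    using card_mono[OF card_doubletons_in_blocks(1)[OF s] I'_sub] card_doubletons_in_blocks(2)[OF s, of n]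
    by linarith

  \<comment> \<open>Second round: one new variable per pair\<close>
  define E' where "E' e = {{l, l'} |l l'. l \<in> x ` e \<and> l' \<in> (\<lambda>q. Pos (v q)) ` Q e}" for e
  \<comment> \<open>A clause determines \<open>a\<close> and \<open>q\<close>, because
    \<open>v q\<close> is not a variable of \<phi>. As the pairs in \<open>M q\<close> are disjoint,
    only one of them contains \<open>a\<close>.\<close>
  have E'_disj: "E' e \<inter> E' e' = {}" if e: "e \<in> I'" "e' \<in> I'" "e \<noteq> e'" for e e'
  proof (rule ccontr)
    assume "E' e \<inter> E' e' \<noteq> {}"
    then obtain a q a' q' where aq: "a \<in> e" "q \<in> Q e" "a' \<in> e'" "q' \<in> Q e'"
      and eq: "{x a, Pos (v q)} = {x a', Pos (v q')}"
      by (auto simp: E'_def)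
    have q: "q \<in> I" "e \<in> M q" "q' \<in> I" "e' \<in> M q'"
      using aq by (auto simp: Q_def)
    have a: "a < n" "a' < n"
      using M(1)[OF q(2)] M(1)[OF q(4)] aq R_n q by blast+
    have "v q \<notin> Var \<phi>" "v q' \<notin> Var \<phi>"
      using v(2) q by auto
    hence "x a \<noteq> Pos (v q')" "x a' \<noteq> Pos (v q)"
      using fV[OF a(1)] fV[OF a(2)] by (auto simp: x_def)
    hence "x a = x a'" "v q = v q'"
      using eq by (auto simp: doubleton_eq_iff)
    hence "a = a'" "q = q'"
      using a q v(1) by (auto simp: x_eq inj_on_def)
    thus False
      using M_disj[of e q e'] q e(3) aq by auto
  qed
  have E'_sub: "{l, l'} \<in> \<psi>" if l: "e \<in> I'" "l \<in> x ` e" "l' \<in> (\<lambda>q. Pos (v q)) ` Q e" for e l l'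
  proof -
    obtain q where q: "q \<in> I" "e \<in> M q" "l' = Pos (v q)"
      using l(3) by (auto simp: Q_def)
    hence "l \<in> x ` R q"
      using M(1)[OF q(2)] l(2) by auto
    with q show ?thesis
      unfolding \<psi>_def by blast
  qed
  have nonempty: "x ` e \<noteq> {} \<and> (\<lambda>q. Pos (v q)) ` Q e \<noteq> {}" if "e \<in> I'" for e
    using that M(2) by (fastforce simp: I'_def Q_def)
  have "finite (Var \<psi>)"
    using \<psi>(1) by (simp add: two_cnf_def finite_Var)
  then obtain u where u: "inj_on u I'" "u ` I' \<inter> Var \<psi> = {}"
    using obtain_fresh_variables[OF finI'] by blast
  define \<chi> where "\<chi> = (\<psi> - (\<Union>e\<in>I'. E' e)) \<union> (\<Union>e\<in>I'. {{l, Pos (u e)} |l. l \<in> x ` e})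
                        \<union> (\<Union>e\<in>I'. {{Neg (u e), l} |l. l \<in> (\<lambda>q. Pos (v q)) ` Q e})"
  have \<chi>: "two_cnf \<chi> \<and> bva_step\<^sup>*\<^sup>* \<psi> \<chi>"
    unfolding \<chi>_def E'_def
    by (rule bva_bicliques) (use finI' \<psi>(1) nonempty E'_sub E'_disj u in \<open>auto simp: E'_def\<close>)

  \<comment> \<open>Counting the clauses that remain\<close>
  let ?T1 = "(`) x ` {{a, b} |a b. a < n \<and> b < n \<and> a div k = b div k}"
  let ?T2 = "{{Neg (v q), x b} |q b. q \<in> I \<and> b \<in> snd q}"
  let ?T3 = "{{x a, Pos (v q)} |q a. q \<in> I \<and> a \<in> R q - \<Union>(M q)}"
  let ?T4 = "{{x a, Pos (u e)} |e a. e \<in> I' \<and> a \<in> e}"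
  let ?T5 = "{{Neg (u e), Pos (v q)} |q e. q \<in> I \<and> e \<in> M q}"
  \<comment> \<open>If \<open>a < b\<close> lie in different column blocks, row \<open>a\<close> is
    above the block of \<open>b\<close>. Its pattern there contains \<open>b\<close>, so it is
    nonempty and its biclique covers the clause.\<close>
  have sub1: "\<phi> - (\<Union>q\<in>I. E q) \<subseteq> ?T1"
  proof
    fix C assume C: "C \<in> \<phi> - (\<Union>q\<in>I. E q)"
    then obtain a b where ab: "a < b" "b < n" "C = {x a, x b}"
      using edge by blast
    have "a div k = b div k"
    proof (rule ccontr)
      assume "a div k \<noteq> b div k"
      with ab have "a div k < b div k"
        using div_le_mono[of a b k] by simp
      hence "a < b div k * k"
        using k by (metis div_less_iff_less_mult)
      hence "a \<in> R (b div k, P a (b div k))" "b \<in> P a (b div k)"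
        using C ab by (auto simp: R_def P_def)
      hence "(b div k, P a (b div k)) \<in> I" "C \<in> E (b div k, P a (b div k))"
        using ab by (auto simp: I_def E_def)
      thus False
        using C by blast
    qed
    hence "{a, b} \<in> {{a, b} |a b. a < n \<and> b < n \<and> a div k = b div k}"
      using ab by fastforce
    moreover have "C = x ` {a, b}"
      using ab by simp
    ultimately show "C \<in> ?T1"
      by blast
  qed
  have sub3: "(\<Union>q\<in>I. {{l, Pos (v q)} |l. l \<in> x ` R q}) - (\<Union>e\<in>I'. E' e) \<subseteq> ?T3"
  proof
    fix C assume C: "C \<in> (\<Union>q\<in>I. {{l, Pos (v q)} |l. l \<in> x ` R q}) - (\<Union>e\<in>I'. E' e)"
    then obtain q a where q: "q \<in> I" "a \<in> R q" "C = {x a, Pos (v q)}"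
      by blast
    have "a \<notin> e" if "e \<in> M q" for e
    proof
      assume "a \<in> e"
      with that q have "e \<in> I'" "C \<in> E' e"
        by (auto simp: I'_def E'_def Q_def)
      with C show False
        by blast
    qed
    with q show "C \<in> ?T3"
      by blast
  qed
  have sub2: "(\<Union>q\<in>I. {{Neg (v q), l} |l. l \<in> x ` snd q}) \<subseteq> ?T2"
    by blast
  have sub4: "(\<Union>e\<in>I'. {{l, Pos (u e)} |l. l \<in> x ` e}) \<subseteq> ?T4"
    by blast
  have sub5: "(\<Union>e\<in>I'. {{Neg (u e), l} |l. l \<in> (\<lambda>q. Pos (v q)) ` Q e}) \<subseteq> ?T5"
    by (auto simp: Q_def)
  have sub: "\<chi> \<subseteq> ?T1 \<union> ?T3 \<union> ?T2 \<union> ?T4 \<union> ?T5"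
    unfolding \<chi>_def \<psi>_def Un_Diff
    by (intro Un_mono sub3 sub4 sub5 order_trans[OF Diff_subset sub1] order_trans[OF Diff_subset sub2])

  have T1: "finite ?T1" "card ?T1 \<le> n * k"
    using card_doubletons_in_blocks[OF k, of n] card_image_le[OF card_doubletons_in_blocks(1)[OF k], of "(`) x" n]
    by (blast, linarith)
  have T2: "finite ?T2"
    by (rule card_setcompr_Sigma_le(1)[OF finI fin_snd])
  have "card ?T2 \<le> (\<Sum>q\<in>I. card (snd q))"
    by (rule card_setcompr_Sigma_le(2)[OF finI fin_snd])
  also have "\<dots> \<le> (\<Sum>q\<in>I. k)"
    by (rule sum_mono[OF card_snd])
  also have "\<dots> \<le> m * 2 ^ k * k"
    using card_I by simp
  finally have T2_card: "card ?T2 \<le> m * 2 ^ k * k" .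
  \<comment> \<open>The pairing leaves at most as many rows as there are row blocks, and these are
    numbered from 0 to \<open>n div s\<close>.\<close>
  have rest: "card (R q - \<Union>(M q)) \<le> n div s + 1" if "q \<in> I" for q
  proof -
    have "(\<lambda>a. a div s) ` R q \<subseteq> {..n div s}"
      using R_n[OF _ that] by (auto intro: div_le_mono less_imp_le)
    hence "card ((\<lambda>a. a div s) ` R q) \<le> n div s + 1"
      using card_mono[of "{..n div s}"] by fastforce
    with M_rest[of q] show ?thesis
      by linarith
  qed
  have T3: "finite ?T3"
    by (rule card_setcompr_Sigma_le(1)[OF finI]) (simp add: finR)
  have "card ?T3 \<le> (\<Sum>q\<in>I. card (R q - \<Union>(M q)))"
    by (rule card_setcompr_Sigma_le(2)[OF finI]) (simp add: finR)
  also have "\<dots> \<le> (\<Sum>q\<in>I. n div s + 1)"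
    by (rule sum_mono[OF rest])
  also have "\<dots> = card I * (n div s + 1)"
    by simp
  also have "\<dots> \<le> m * 2 ^ k * (n div s + 1)"
    using card_I by (rule mult_right_mono) simp
  finally have T3_card: "card ?T3 \<le> m * 2 ^ k * (n div s + 1)" .
  have card_e: "finite e \<and> card e = 2" if "e \<in> I'" for e
    using that M(2) by (force simp: I'_def intro: card_ge_0_finite)
  have T4: "finite ?T4"
    by (rule card_setcompr_Sigma_le(1)[OF finI']) (simp add: card_e)
  have "card ?T4 \<le> (\<Sum>e\<in>I'. card e)"
    by (rule card_setcompr_Sigma_le(2)[OF finI']) (simp add: card_e)
  also have "\<dots> = 2 * card I'"
    using card_e by simp
  also have "\<dots> \<le> 2 * (n * s)"
    using card_I' by simp
  finally have T4_card: "card ?T4 \<le> 2 * (n * s)" .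
  \<comment> \<open>A row has only one pattern in a given column block, so the block and
    \<open>a\<close> determine \<open>q\<close>. Block \<open>j\<close> has \<open>j * k\<close>
    rows above it; summing over \<open>j\<close> gives the factor 1/2 of the triangle.\<close>
  have "(\<Sum>q\<in>I. card (R q)) = card (Sigma I R)"
    using finI finR by simp
  also have "\<dots> \<le> card (Sigma {..<m} (\<lambda>j. {..<j * k}))"
  proof (rule card_inj_on_le)
    show "inj_on (\<lambda>(q, a). (fst q, a)) (Sigma I R)"
      by (auto simp: inj_on_def R_def)
    show "(\<lambda>(q, a). (fst q, a)) ` Sigma I R \<subseteq> Sigma {..<m} (\<lambda>j. {..<j * k})"
      using I_sub by (fastforce simp: R_def)
  qed auto
  also have "\<dots> = (\<Sum>j<m. j * k)"
    by simp
  finally have "2 * (\<Sum>q\<in>I. card (R q)) \<le> 2 * (\<Sum>j<m. j) * k"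
    by (simp add: sum_distrib_right)
  also have "2 * (\<Sum>j<m. j) = m * (n div k)"
    using gauss_sum_nat[of "n div k"] by (simp add: m_def atMost_atLeast0 lessThan_Suc_atMost)
  also have "m * (n div k) * k \<le> n * m"
    by (simp add: mult.commute mult.left_commute)
  finally have R_sum: "2 * (\<Sum>q\<in>I. card (R q)) \<le> n * m" .
  have T5: "finite ?T5"
    by (rule card_setcompr_Sigma_le(1)[OF finI finM])
  \<comment> \<open>There are at most half as many pairs in \<open>M q\<close> as rows in
    \<open>R q\<close>. With the 1/2 of the triangle, this is where the constant 1/4 arises.\<close>
  have "4 * card ?T5 \<le> 4 * (\<Sum>q\<in>I. card (M q))"
    by (intro mult_left_mono card_setcompr_Sigma_le(2)[OF finI finM]) simp
  also have "\<dots> = 2 * (\<Sum>q\<in>I. 2 * card (M q))"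
    by (simp flip: sum_distrib_left)
  also have "\<dots> \<le> 2 * (\<Sum>q\<in>I. card (R q))"
    by (intro mult_left_mono sum_mono M_card) simp
  also note R_sum
  finally have T5_card: "4 * card ?T5 \<le> n * m" .

  have "card \<chi> \<le> card (?T1 \<union> ?T3 \<union> ?T2 \<union> ?T4 \<union> ?T5)"
    by (intro card_mono[OF _ sub] finite_UnI T1(1) T2 T3 T4 T5)
  also have "\<dots> \<le> card ?T1 + card ?T3 + card ?T2 + card ?T4 + card ?T5"
    by (intro order_trans[OF card_Un_le] add_mono order_refl)
  also have "\<dots> \<le> n * k + m * 2 ^ k * (n div s + 1) + m * 2 ^ k * k + 2 * (n * s) + card ?T5"
    by (intro add_mono T1(2) T2_card T3_card T4_card order_refl)
  finally have "real (card \<chi>)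
      \<le> real (n * k + m * 2 ^ k * k + m * 2 ^ k * (n div s + 1) + 2 * (n * s)) + real (card ?T5)"
    by linarith
  moreover have "real (card ?T5) \<le> real (n * m) / 4"
    using T5_card by linarith
  ultimately have "real (card \<chi>)
      \<le> real (n * k + m * 2 ^ k * k + m * 2 ^ k * (n div s + 1) + 2 * (n * s)) + real (n * m) / 4"
    by (rule order_trans[OF _ add_left_mono])
  thus ?thesis
    using \<chi> \<psi>(2) by (meson rtranclp_trans)
qed

section \<open>The trivial bound for small n\<close>

text \<open>Meant for those \<open>n\<close> that are too small for the logarithmic parameters;
  there \<phi> itself is short enough.\<close>

lemma card_monotone_two_cnf_le:
  assumes mono: "monotone_formula \<phi>" and \<phi>: "two_cnf \<phi>"
  shows "card \<phi> \<le> card (Var \<phi>) choose 2"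
proof -
  have finV: "finite (Var \<phi>)"
    using \<phi> by (simp add: two_cnf_def finite_Var)
  have "C \<subseteq> Pos ` Var \<phi>" if C: "C \<in> \<phi>" for C
  proof
    fix l assume l: "l \<in> C"
    obtain y where "l = Pos y"
      using mono C l unfolding monotone_formula_def by blast
    thus "l \<in> Pos ` Var \<phi>"
      using var_of_in_Var[OF C l] by simp
  qed
  hence "\<phi> \<subseteq> {C. C \<subseteq> Pos ` Var \<phi> \<and> card C = 2}"
    using \<phi> by (auto simp: two_cnf_def)
  hence "card \<phi> \<le> card {C. C \<subseteq> Pos ` Var \<phi> \<and> card C = 2}"
    using finV by (intro card_mono) auto
  also have "\<dots> = card (Pos ` Var \<phi>) choose 2"
    using finV by (intro n_subsets) auto
  also have "card (Pos ` Var \<phi>) = card (Var \<phi>)"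
    by (intro card_image) (auto simp: inj_on_def)
  finally show ?thesis .
qed

section \<open>Choice of the parameters and asymptotics\<close>

text \<open>
  The bound of \<open>bva_pattern_bound\<close> for \<open>2 ^ k \<approx> n / L ^ 3\<close> and \<open>s \<approx> n / L\<^sup>2\<close>, where
  \<open>L = log 2 n\<close>: the row blocks are longer than the number of patterns by a factor \<open>L\<close>, so
  unpaired rows are rare, while there are still only \<open>o (n\<^sup>2 / L)\<close> pairs inside row blocks.
\<close>

definition bva_size :: "real \<Rightarrow> real" where
  "bva_size n = (let L = log 2 n; m = n / (L - 3 * log 2 L - 1) + 1 in
     n * L + m * (n / L ^ 3) * L + m * (n / L ^ 3) * (L\<^sup>2 + 1) + 2 * (n * (n / L\<^sup>2 + 1)) + n * m / 4)"

text \<open>With \<open>L = log 2 n\<close>, the term \<open>n * m / 4\<close> contributes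
  \<open>L / (4 * (L - 3 * log 2 L - 1))\<close> up to a vanishing error, which tends to 1/4. Every
  other term of \<open>bva_size\<close> is of order at most
  \<open>n\<^sup>2 / L\<^sup>2\<close>.\<close>

lemma bva_size_asymptotics:
  "(\<lambda>n. bva_size (real n) * log 2 (real n) / (real n)\<^sup>2 - 1 / 4) \<longlonglongrightarrow> 0"
  unfolding bva_size_def Let_def by real_asymp

text \<open>\<open>bva_size\<close> absorbs the rounding: taking \<open>k\<close> as a floor costs
  the 1 subtracted in the denominator of \<open>m\<close>, and taking \<open>s\<close> as a ceiling
  costs the 1 added to \<open>n / L\<^sup>2\<close>. Assumption \<open>K\<close> makes that
  denominator positive and forces \<open>k > 0\<close>.\<close>

lemma bva_size_bound:
  fixes \<phi> :: "'v::infinite literal set set"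
  assumes \<phi>: "monotone_formula \<phi>" "two_cnf \<phi>" "card (Var \<phi>) = n"
  defines "L \<equiv> log 2 (real n)"
  assumes L: "L > 1" and K: "L - 3 * log 2 L - 1 > 0"
  shows "\<exists>\<phi>'. two_cnf \<phi>' \<and> bva_step\<^sup>*\<^sup>* \<phi> \<phi>' \<and> real (card \<phi>') \<le> bva_size (real n)"
proof -
  define k where "k = nat \<lfloor>L - 3 * log 2 L\<rfloor>"
  define s where "s = nat \<lceil>real n / L\<^sup>2\<rceil>"
  define m where "m = n div k + 1"
  define m' where "m' = real n / (L - 3 * log 2 L - 1) + 1"
  \<comment> \<open>The logarithm of 0 is 0 by convention, which \<open>L > 1\<close>
    excludes.\<close>
  have n: "n > 0"
    using L by (cases "n = 0") (auto simp: L_def log_def)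
  have k_bounds: "real k \<le> L - 3 * log 2 L" "L - 3 * log 2 L - 1 < real k"
    using K unfolding k_def by linarith+
  have lgL: "log 2 L > 0"
    using L by simp
  have k: "k > 0"
    using k_bounds(2) K by (cases "k = 0") auto
  have quot: "real n / L\<^sup>2 > 0"
    using n L by simp
  hence s: "s > 0" and s_bounds: "real n / L\<^sup>2 \<le> real s" "real s \<le> real n / L\<^sup>2 + 1"
    unfolding s_def by linarith+
  have k_le: "real k \<le> L"
    using k_bounds(1) lgL by linarith
  have "(2::real) ^ k = 2 powr real k"
    by (simp add: powr_realpow)
  also have "\<dots> \<le> 2 powr (L - 3 * log 2 L)"
    using k_bounds(1) by simp
  also have "\<dots> = 2 powr L / (2 powr log 2 L) powr 3"
    by (simp add: powr_diff powr_powr mult.commute)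
  also have "\<dots> = real n / L ^ 3"
    using n L by (simp add: L_def powr_numeral)
  finally have pow: "(2::real) ^ k \<le> real n / L ^ 3" .
  have "real (n div k) \<le> real n / real k"
    by (rule of_nat_div_le_of_nat)
  also have "\<dots> \<le> real n / (L - 3 * log 2 L - 1)"
    using k_bounds(2) K by (intro divide_left_mono mult_pos_pos) auto
  finally have m: "real m \<le> m'"
    by (simp add: m_def m'_def)
  have "real (n div s) \<le> real n / real s"
    by (rule of_nat_div_le_of_nat)
  also have "\<dots> \<le> real n / (real n / L\<^sup>2)"
    using s_bounds(1) quot by (intro divide_left_mono mult_pos_pos) auto
  also have "\<dots> = L\<^sup>2"
    using n by simp
  finally have ns: "real (n div s + 1) \<le> L\<^sup>2 + 1"
    by simp
  have m'_nonneg: "0 \<le> m'" "0 \<le> real n / L ^ 3"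
    using K L by (auto simp: m'_def)
  from bva_pattern_bound[OF \<phi> k s] obtain \<phi>' where \<phi>': "two_cnf \<phi>'" "bva_step\<^sup>*\<^sup>* \<phi> \<phi>'"
    "real (card \<phi>') \<le> real (n * k + m * 2 ^ k * k + m * 2 ^ k * (n div s + 1) + 2 * (n * s)) + real (n * m) / 4"
    unfolding m_def by blast
  note \<phi>'(3)
  also have "real (n * k + m * 2 ^ k * k + m * 2 ^ k * (n div s + 1) + 2 * (n * s)) + real (n * m) / 4
     = real n * real k + real m * 2 ^ k * real k + real m * 2 ^ k * real (n div s + 1)
       + 2 * (real n * real s) + real n * real m / 4"
    by (simp add: algebra_simps)
  also have "\<dots> \<le> real n * L + m' * (real n / L ^ 3) * L + m' * (real n / L ^ 3) * (L\<^sup>2 + 1)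
       + 2 * (real n * (real n / L\<^sup>2 + 1)) + real n * m' / 4"
    using k_le pow m ns s_bounds(2) m'_nonneg
    by (intro add_mono mult_mono divide_right_mono order_refl) auto
  also have "\<dots> = bva_size (real n)"
    by (simp add: bva_size_def Let_def L_def m'_def)
  finally show ?thesis
    using \<phi>'(1,2) by blast
qed

theorem theorem26:
  "\<exists>\<epsilon> :: nat \<Rightarrow> real. \<epsilon> \<longlonglongrightarrow> 0 \<and>
     (\<forall>n. \<forall>\<phi> :: 'v::infinite literal set set.
        monotone_formula \<phi> \<and> two_cnf \<phi> \<and> card (Var \<phi>) = n \<longrightarrow>
        (\<exists>\<phi>'. two_cnf \<phi>' \<and> bva_step\<^sup>*\<^sup>* \<phi> \<phi>' \<and>
           real (card \<phi>') \<le> (1 / 4 + \<epsilon> n) * ((real n)\<^sup>2 / log 2 (real n))))"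
proof -
  define large where
    "large n \<longleftrightarrow> log 2 (real n) > 1 \<and> log 2 (real n) - 3 * log 2 (log 2 (real n)) - 1 > 0" for n
  \<comment> \<open>For large \<open>n\<close> this choice turns the claimed bound into
    \<open>bva_size n\<close>. Otherwise, if \<open>n \<ge> 2\<close>, the value
    \<open>log 2 n\<close> cancels the denominator and the bound is at least
    \<open>n\<^sup>2\<close>, so no BVA step has to be made.\<close>
  define \<epsilon> where "\<epsilon> n = (if large n then bva_size (real n) * log 2 (real n) / (real n)\<^sup>2 - 1 / 4
    else log 2 (real n))" for n
  have "eventually large sequentially"
    unfolding large_def by (intro eventually_conj; real_asymp)
  hence "eventually (\<lambda>n. \<epsilon> n = bva_size (real n) * log 2 (real n) / (real n)\<^sup>2 - 1 / 4) sequentially"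
    by eventually_elim (simp add: \<epsilon>_def)
  hence "\<epsilon> \<longlonglongrightarrow> 0"
    using bva_size_asymptotics by (simp add: tendsto_cong)
  moreover have "\<exists>\<phi>'. two_cnf \<phi>' \<and> bva_step\<^sup>*\<^sup>* \<phi> \<phi>' \<and>
           real (card \<phi>') \<le> (1 / 4 + \<epsilon> n) * ((real n)\<^sup>2 / log 2 (real n))"
    if \<phi>: "monotone_formula \<phi>" "two_cnf \<phi>" "card (Var \<phi>) = n" for n and \<phi> :: "'v literal set set"
  proof (cases "large n")
    case True
    hence lg: "log 2 (real n) > 0"
      by (simp add: large_def)
    hence "n > 0"
      by (cases "n = 0") (auto simp: log_def)
    hence "(1 / 4 + \<epsilon> n) * ((real n)\<^sup>2 / log 2 (real n)) = bva_size (real n)"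
      using True lg[THEN less_imp_neq] by (simp add: \<epsilon>_def)
    thus ?thesis
      using bva_size_bound[OF \<phi>] True by (auto simp: large_def)
  next
    case False
    have le: "card \<phi> \<le> n choose 2"
      using card_monotone_two_cnf_le[OF \<phi>(1,2)] \<phi>(3) by simp
    have "real (card \<phi>) \<le> (1 / 4 + \<epsilon> n) * ((real n)\<^sup>2 / log 2 (real n))"
    proof (cases "n \<ge> 2")
      case True
      hence lg: "log 2 (real n) > 0"
        by simp
      have "n choose 2 \<le> n ^ 2"
        using True by (rule binomial_le_pow)
      hence "real (card \<phi>) \<le> real (n\<^sup>2)"
        using le by (simp only: of_nat_le_iff)
      also have "\<dots> = log 2 (real n) * ((real n)\<^sup>2 / log 2 (real n))"
        using lg by simp
      also have "\<dots> \<le> (1 / 4 + \<epsilon> n) * ((real n)\<^sup>2 / log 2 (real n))"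
        using lg False by (intro mult_right_mono) (auto simp: \<epsilon>_def)
      finally show ?thesis .
    next
      case False
      \<comment> \<open>Here \<open>log 2 n\<close> is 0 and division by 0 gives 0, so the
        right-hand side vanishes; \<phi> has no clauses either.\<close>
      hence "n = 0 \<or> n = 1"
        by linarith
      thus ?thesis
        using le by (auto simp: binomial_eq_0)
    qed
    thus ?thesis
      using \<phi>(2) by blast
  qed
  ultimately show ?thesis
    by blast
qed

end
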